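(* Let $\theta$ be an action of an inverse semigroup $S$ on a locally compact Hausdorff space $X$. Then $\widetilde{X^{\mathrm{KS}}}$ is compact and Hausdorff with respect to the topology inherited from the product topology on $\prod_{e\in E(S)}\widetilde{X_e}$. In particular, $X^{\mathrm{KS}}$ is locally compact Hausdorff.
   Context: An inverse semigroup is a semigroup $S$ in which every $s$ has a unique $s^*$ with $ss^*s=s$, $s^*ss^*=s^*$; $E(S)$ is its commutative subsemigroup of idempotents; $s\le t$ means $ts^*s=s$. An action $\theta$ of $S$ on a topological space $X$ is a semigroup homomorphism $s\mapsto\theta_s$ from $S$ to the inverse semigroup of partial bijections of $X$ (bijections between subsets, composed on the largest possible domain) such that, writing $X_e$ for the subset on which $\theta_e$ ($e\in E(S)$) is the identity (so $\theta_s$ is a bijection $X_{s^*s}\to X_{ss^*}$): each $X_e$ is open, each $\theta_s\colon X_{s^*s}\to X_{ss^*}$ is continuous, and $\bigcup_{e\in E(S)}X_e=X$. For each $e\in E(S)$ let $\widetilde{X_e}=X_e\sqcup\{\infty_e\}$ be the one-point compactification of $X_e$ (a point $\infty_e$ is added even when $X_e$ is compact). $\widetilde{X^{\mathrm{KS}}}$ is the set of $\tau\in\prod_{e\in E(S)}\widetilde{X_e}$ such that (1) if $e_1\le e_2$ and $\tau(e_1)\ne\infty_{e_1}$, then $\tau(e_2)=\tau(e_1)$ (as points of $X$); (2) if $\tau(e_1)\neq\infty_{e_1}$ and $\tau(e_2)\neq\infty_{e_2}$, then $\tau(e_1e_2)\neq\infty_{e_1e_2}$. $X^{\mathrm{KS}}=\widetilde{X^{\mathrm{KS}}}\setminus\{\infty\}$,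 where $\infty=(\infty_e)_{e\in E(S)}$. *)

theory Defs
  imports "HOL-Analysis.Analysis"
begin

locale inverse_semigroup =
  fixes S :: "'s set" and mult :: "'s \<Rightarrow> 's \<Rightarrow> 's" (infixl "\<cdot>" 70)
  assumes closed: "\<lbrakk>s \<in> S; t \<in> S\<rbrakk> \<Longrightarrow> s \<cdot> t \<in> S"
    and assoc: "\<lbrakk>r \<in> S; s \<in> S; t \<in> S\<rbrakk> \<Longrightarrow> (r \<cdot> s) \<cdot> t = r \<cdot> (s \<cdot> t)"
    and ex1_star: "s \<in> S \<Longrightarrow> \<exists>!t. t \<in> S \<and> s \<cdot> t \<cdot> s = s \<and> t \<cdot> s \<cdot> t = t"
begin

definition star :: "'s \<Rightarrow> 's"
  where "star s = (THE t. t \<in> S \<and> s \<cdot> t \<cdot> s = s \<and> t \<cdot> s \<cdot> t = t)"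

definition idempotents :: "'s set"
  where "idempotents = {e \<in> S. e \<cdot> e = e}"

definition below :: "'s \<Rightarrow> 's \<Rightarrow> bool"
  where "below s t \<longleftrightarrow> t \<cdot> (star s \<cdot> s) = s"

end

text \<open>
  Partial bijections of a set \<open>A\<close>, as partial maps. Map composition \<open>f \<circ>\<^sub>m g\<close> (first \<open>g\<close>)
  is defined exactly on the largest possible domain.
\<close>

definition partial_bijection :: "'x set \<Rightarrow> ('x \<rightharpoonup> 'x) \<Rightarrow> bool"
  where "partial_bijection A f \<longleftrightarrow> dom f \<subseteq> A \<and> ran f \<subseteq> A \<and> inj_on f (dom f)"

text \<open>For idempotent \<open>e\<close> this is \<open>X\<^sub>e\<close>; it coincides with the domain of \<open>\<theta> e\<close>.\<close>

definition fix_dom :: "('s \<Rightarrow> 'x \<rightharpoonup> 'x) \<Rightarrow> 's \<Rightarrow> 'x set"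
  where "fix_dom \<theta> e = {x. \<theta> e x = Some x}"

locale inverse_semigroup_action = inverse_semigroup S mult
  for S :: "'s set" and mult :: "'s \<Rightarrow> 's \<Rightarrow> 's" (infixl "\<cdot>" 70) +
  fixes X :: "'x topology" and \<theta> :: "'s \<Rightarrow> 'x \<rightharpoonup> 'x"
  assumes partial_bijection: "s \<in> S \<Longrightarrow> partial_bijection (topspace X) (\<theta> s)"
    and hom: "\<lbrakk>s \<in> S; t \<in> S\<rbrakk> \<Longrightarrow> \<theta> (s \<cdot> t) = \<theta> s \<circ>\<^sub>m \<theta> t"
    and open_dom: "e \<in> idempotents \<Longrightarrow> openin X (fix_dom \<theta> e)"
    and continuous: "s \<in> S \<Longrightarrow>
      continuous_map (subtopology X (fix_dom \<theta> (star s \<cdot> s)))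
        (subtopology X (fix_dom \<theta> (s \<cdot> star s))) (\<lambda>x. the (\<theta> s x))"
    and cover: "(\<Union>e\<in>idempotents. fix_dom \<theta> e) = topspace X"
begin

text \<open>
  The point at infinity is \<^const>\<open>None\<close>, which the library's compactification adds even when the
  space is compact. Condition (1) compares points of different \<open>X\<^sub>e\<close> inside the common type
  of points of \<open>X\<close>.
\<close>

definition product_space :: "('s \<Rightarrow> 'x option) topology"
  where "product_space =
    product_topology (\<lambda>e. Alexandroff_compactification (subtopology X (fix_dom \<theta> e))) idempotents"

definition KS_tilde :: "('s \<Rightarrow> 'x option) set"
  where "KS_tilde = {\<tau> \<in> topspace product_space.
     (\<forall>e1\<in>idempotents. \<forall>e2\<in>idempotents. below e1 e2 \<and> \<tau> e1 \<noteq> None \<longrightarrow> \<tau> e2 = \<tau> e1) \<and>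
     (\<forall>e1\<in>idempotents. \<forall>e2\<in>idempotents. \<tau> e1 \<noteq> None \<and> \<tau> e2 \<noteq> None \<longrightarrow> \<tau> (e1 \<cdot> e2) \<noteq> None)}"

definition KS :: "('s \<Rightarrow> 'x option) set"
  where "KS = KS_tilde - {\<lambda>e\<in>idempotents. None}"

definition KS_tilde_space :: "('s \<Rightarrow> 'x option) topology"
  where "KS_tilde_space = subtopology product_space KS_tilde"

definition KS_space :: "('s \<Rightarrow> 'x option) topology"
  where "KS_space = subtopology KS_tilde_space KS"

end

end

theory Submission imports Defs begin

text \<open>
  Each \<open>X\<^sub>e\<close> is an open subset of a locally compact Hausdorff space, so its one-point
  compactification is compact Hausdorff, and by Tychonoff so is the product. Everything then
  rests on \<open>closedin_KS_tilde\<close>: the two conditions defining \<open>KS_tilde\<close>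
  cut out a closed subset of the product. Removing one point from a compact Hausdorff
  space leaves an open subspace, which is locally compact Hausdorff.

  Condition (1) is closed on its own. Condition (2) is not: it requires
  \<open>\<tau> (e \<cdot> f) \<noteq> \<infinity>\<close>, and finite values can converge to \<open>\<infinity>\<close>. In the presence of (1) this cannot
  happen. A value at \<open>e \<cdot> f\<close> has to agree with the values at \<open>e\<close> and at \<open>f\<close>, because
  \<open>e \<cdot> f\<close> lies below both. If the values at \<open>e\<close> and \<open>f\<close> have finite limits \<open>x\<close> and \<open>y\<close>, then
  \<open>x = y\<close> since \<open>X\<close> is Hausdorff, and this point lies in
  \<open>X\<^sub>e \<inter> X\<^sub>f = X\<^bsub>e\<cdot>f\<^esub>\<close>; so the value at \<open>e \<cdot> f\<close> converges to the finite point \<open>x\<close> as well.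
  The proof phrases this with open neighbourhoods in the complement instead of limits.

  The algebra enters through two facts: idempotents of an inverse semigroup commute
  (\<open>idempotents_commute\<close>), which makes \<open>e \<cdot> f\<close> an idempotent below both factors, and an
  action turns products of idempotents into intersections of domains (\<open>fix_dom_mult\<close>).
\<close>

section \<open>Idempotents of an inverse semigroup\<close>

context inverse_semigroup
begin

lemma star_eqI:
  assumes "s \<in> S" "t \<in> S" "s \<cdot> t \<cdot> s = s" "t \<cdot> s \<cdot> t = t"
  shows "star s = t"
  unfolding star_def using assms by (intro the1_equality[OF ex1_star]) auto

lemma star_props:
  assumes "s \<in> S"
  shows "star s \<in> S" "s \<cdot> star s \<cdot> s = s" "star s \<cdot> s \<cdot> star s = star s"
  using theI'[OF ex1_star[OF assms]] unfolding star_def by auto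

lemma idempotentsD: "e \<in> idempotents \<Longrightarrow> e \<in> S" "e \<in> idempotents \<Longrightarrow> e \<cdot> e = e"
  by (auto simp: idempotents_def)

lemma star_idempotent: "e \<in> idempotents \<Longrightarrow> star e = e"
  by (rule star_eqI) (simp_all add: idempotentsD)

lemma below_idempotent_iff:
  "e \<in> idempotents \<Longrightarrow> below e f \<longleftrightarrow> f \<cdot> e = e"
  by (simp add: below_def star_idempotent idempotentsD)

text \<open>
  With \<open>x = star (e \<cdot> f)\<close>, the element \<open>f \<cdot> x \<cdot> e\<close> is another inverse of \<open>e \<cdot> f\<close>, so it equals \<open>x\<close>;
  in this form \<open>x\<close> is visibly idempotent. An idempotent is its own inverse, and \<open>e \<cdot> f\<close> is an
  inverse of \<open>x\<close>, so \<open>e \<cdot> f = x\<close>.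
\<close>

lemma idempotents_closed:
  assumes e: "e \<in> idempotents" and f: "f \<in> idempotents"
  shows "e \<cdot> f \<in> idempotents"
proof -
  note [simp] = idempotentsD[OF e] idempotentsD[OF f] closed
  define x where "x = star (e \<cdot> f)"
  have x[simp]: "x \<in> S" and efx: "(e \<cdot> f) \<cdot> x \<cdot> (e \<cdot> f) = e \<cdot> f" and xef: "x \<cdot> (e \<cdot> f) \<cdot> x = x"
    using star_props[of "e \<cdot> f"] by (auto simp: x_def)
  have ee: "e \<cdot> (e \<cdot> y) = e \<cdot> y" and ff: "f \<cdot> (f \<cdot> y) = f \<cdot> y" if "y \<in> S" for y
    using that by (simp_all flip: assoc)
  have efx': "e \<cdot> (f \<cdot> (x \<cdot> (e \<cdot> f))) = e \<cdot> f"
    using efx by (simp add: assoc)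
  have xef': "x \<cdot> (e \<cdot> (f \<cdot> (x \<cdot> y))) = x \<cdot> y" if "y \<in> S" for y
    using arg_cong[OF xef, of "\<lambda>z. z \<cdot> y"] that by (simp add: assoc)
  have "star (e \<cdot> f) = f \<cdot> x \<cdot> e"
    by (rule star_eqI) (simp_all add: assoc ee ff efx' xef')
  then have x_eq: "x = f \<cdot> x \<cdot> e"
    by (simp add: x_def)
  have "(f \<cdot> x \<cdot> e) \<cdot> (f \<cdot> x \<cdot> e) = f \<cdot> x \<cdot> e"
    by (simp add: assoc xef')
  then have x_idem: "x \<in> idempotents"
    by (simp add: idempotents_def flip: x_eq)
  have "star x = e \<cdot> f"
    by (rule star_eqI) (use efx xef in simp_all)
  then show ?thesis
    using star_idempotent[OF x_idem] x_idem by simp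
qed

text \<open>
  Once products of idempotents are idempotent, both \<open>e \<cdot> f\<close> and \<open>f \<cdot> e\<close> are inverses of \<open>e \<cdot> f\<close>.
\<close>

lemma idempotents_commute:
  assumes e: "e \<in> idempotents" and f: "f \<in> idempotents"
  shows "e \<cdot> f = f \<cdot> e"
proof -
  note [simp] = idempotentsD[OF e] idempotentsD[OF f] closed
  have ee: "e \<cdot> (e \<cdot> y) = e \<cdot> y" and ff: "f \<cdot> (f \<cdot> y) = f \<cdot> y" if "y \<in> S" for y
    using that by (simp_all flip: assoc)
  have ef: "e \<cdot> (f \<cdot> (e \<cdot> f)) = e \<cdot> f"
    using idempotentsD(2)[OF idempotents_closed[OF e f]] by (simp add: assoc)
  have fe: "f \<cdot> (e \<cdot> (f \<cdot> e)) = f \<cdot> e"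
    using idempotentsD(2)[OF idempotents_closed[OF f e]] by (simp add: assoc)
  have "star (e \<cdot> f) = f \<cdot> e"
    by (rule star_eqI) (simp_all add: assoc ee ff ef fe)
  then show ?thesis
    using star_idempotent[OF idempotents_closed[OF e f]] by simp
qed

text \<open>
  The second claim is where commutativity is indispensable: in a band that is not a semilattice,
  \<open>f \<cdot> (e \<cdot> f)\<close> can differ from \<open>e \<cdot> f\<close>.
\<close>

lemma below_mult:
  assumes e: "e \<in> idempotents" and f: "f \<in> idempotents"
  shows "below (e \<cdot> f) e" "below (e \<cdot> f) f"
proof -
  note [simp] = idempotentsD[OF e] idempotentsD[OF f] closed
  have "e \<cdot> (e \<cdot> f) = e \<cdot> f"
    by (simp flip: assoc)
  then show "below (e \<cdot> f) e"
    using e f by (simp add: below_idempotent_iff idempotents_closed)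
  have "f \<cdot> (f \<cdot> e) = f \<cdot> e"
    by (simp flip: assoc)
  then show "below (e \<cdot> f) f"
    using e f by (simp add: below_idempotent_iff idempotents_closed idempotents_commute[OF e f])
qed

end

section \<open>One-point compactifications of open subsets\<close>

lemma Hausdorff_space_Alexandroff_compactification_open_subset:
  assumes "locally_compact_space X" "Hausdorff_space X" "openin X U"
  shows "Hausdorff_space (Alexandroff_compactification (subtopology X U))"
  using assms unfolding Hausdorff_space_Alexandroff_compactification
  by (intro conjI locally_compact_space_open_subset Hausdorff_space_subtopology disjI1)

text \<open>
  The Hausdorff property of the compactification of \<open>U\<close>, with the neighbourhood of the finite
  point \<open>x\<close> taken in \<open>X\<close>. Being open in \<open>X\<close>, the set \<open>G\<close> can also serve as a neighbourhood
  of \<open>x\<close> in a different set \<open>X\<^sub>e\<close>; this is how two coordinates of a point of the product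
  are compared.
\<close>

lemma separate_in_Alexandroff_compactification:
  assumes "locally_compact_space X" "Hausdorff_space X" "openin X U"
    and x: "x \<in> U"
    and v: "v \<in> topspace (Alexandroff_compactification (subtopology X U))" "v \<noteq> Some x"
  obtains G N where "openin X G" "x \<in> G"
    "openin (Alexandroff_compactification (subtopology X U)) N" "v \<in> N" "Some ` G \<inter> N = {}"
proof -
  let ?A = "Alexandroff_compactification (subtopology X U)"
  have U: "U \<subseteq> topspace X"
    using assms by (simp add: openin_subset)
  have "Hausdorff_space ?A"
    using assms by (intro Hausdorff_space_Alexandroff_compactification_open_subset)
  moreover have "Some x \<in> topspace ?A"
    using x U by auto
  ultimately obtain M N where M: "openin ?A M" "Some x \<in> M" and N: "openin ?A N" "v \<in> N"
    and disj: "disjnt M N"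
    unfolding Hausdorff_space_def using v by metis
  define G where "G = {z \<in> topspace (subtopology X U). Some z \<in> M}"
  have "openin (subtopology X U) G"
    unfolding G_def
    by (rule openin_continuous_map_preimage[OF continuous_map_Some M(1)])
  then have "openin X G"
    using \<open>openin X U\<close> by (rule openin_trans_full)
  moreover have "x \<in> G"
    using x U M by (auto simp: G_def)
  moreover have "Some ` G \<inter> N = {}"
    using disj by (auto simp: G_def disjnt_def)
  ultimately show thesis
    using N that by blast
qed

lemma openin_Alexandroff_compactification_Some:
  assumes "openin X G"
  shows "openin (Alexandroff_compactification (subtopology X U)) (Some ` (U \<inter> G))"
  using assms by (simp add: openin_subtopology_Int2)

section \<open>The coordinates of points of the product\<close>

context inverse_semigroup_action
begin

text \<open>
  If \<open>\<theta> e\<close> sends \<open>x\<close> to \<open>y\<close>, then idempotence makes it send \<open>y\<close> to \<open>y\<close> too, and injectivity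
  forces \<open>x = y\<close>. Hence \<open>fix_dom \<theta> e\<close> is the whole domain of \<open>\<theta> e\<close>.
\<close>

lemma idempotent_acts_as_identity:
  assumes e: "e \<in> idempotents" and xy: "\<theta> e x = Some y"
  shows "y = x"
proof -
  have "\<theta> e = \<theta> e \<circ>\<^sub>m \<theta> e"
    using hom[of e e] e by (simp add: idempotentsD)
  then have "\<theta> e y = Some y"
    using xy by (metis map_comp_simps(2))
  moreover have "inj_on (\<theta> e) (dom (\<theta> e))"
    using partial_bijection[of e] e by (simp add: partial_bijection_def idempotentsD)
  ultimately show ?thesis
    using xy by (metis domI inj_onD)
qed

lemma fix_dom_mult:
  assumes "e \<in> idempotents" "f \<in> idempotents"
  shows "fix_dom \<theta> (e \<cdot> f) = fix_dom \<theta> e \<inter> fix_dom \<theta> f"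
proof -
  have "\<theta> (e \<cdot> f) = \<theta> e \<circ>\<^sub>m \<theta> f"
    using assms by (intro hom) (auto simp: idempotentsD)
  then show ?thesis
    using idempotent_acts_as_identity[OF assms(1)] idempotent_acts_as_identity[OF assms(2)]
    by (fastforce simp: fix_dom_def map_comp_def split: option.splits)
qed

lemma fix_dom_mono:
  assumes e: "e \<in> idempotents" and f: "f \<in> idempotents" and "below e f"
  shows "fix_dom \<theta> e \<subseteq> fix_dom \<theta> f"
  using fix_dom_mult[OF f e] assms by (auto simp: below_idempotent_iff)

lemma openin_product_space_coordinate:
  assumes "e \<in> idempotents"
    and "openin (Alexandroff_compactification (subtopology X (fix_dom \<theta> e))) N"
  shows "openin product_space {\<tau> \<in> topspace product_space. \<tau> e \<in> N}"
  unfolding product_space_def using assms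
  by (intro openin_continuous_map_preimage[OF continuous_map_product_projection]) auto

lemma product_space_coordinate:
  assumes "\<tau> \<in> topspace product_space" "e \<in> idempotents"
  shows "\<tau> e \<in> topspace (Alexandroff_compactification (subtopology X (fix_dom \<theta> e)))"
    and "\<tau> e = Some x \<Longrightarrow> x \<in> fix_dom \<theta> e"
proof -
  show coord: "\<tau> e \<in> topspace (Alexandroff_compactification (subtopology X (fix_dom \<theta> e)))"
    using assms unfolding product_space_def topspace_product_topology by (rule PiE_mem)
  show "\<tau> e = Some x \<Longrightarrow> x \<in> fix_dom \<theta> e"
    using coord by auto
qed

lemma KS_tilde_extend:
  assumes "\<tau> \<in> KS_tilde" "e \<in> idempotents" "f \<in> idempotents" "below e f" "\<tau> e = Some x"
  shows "\<tau> f = Some x"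
proof -
  have "below e f \<and> \<tau> e \<noteq> None \<longrightarrow> \<tau> f = \<tau> e"
    using assms(1-3) unfolding KS_tilde_def by blast
  then show ?thesis
    using assms(4,5) by simp
qed

text \<open>
  Condition (2) provides a finite value at \<open>e \<cdot> f\<close>, and condition (1) carries it up to
  \<open>e\<close> and to \<open>f\<close>.
\<close>

lemma KS_tilde_coordinates_agree:
  assumes \<tau>: "\<tau> \<in> KS_tilde" and e: "e \<in> idempotents" and f: "f \<in> idempotents"
    and x: "\<tau> e = Some x" and y: "\<tau> f = Some y"
  shows "y = x" "\<tau> (e \<cdot> f) = Some x"
proof -
  obtain z where z: "\<tau> (e \<cdot> f) = Some z"
    using assms unfolding KS_tilde_def by blast
  have "\<tau> e = Some z" "\<tau> f = Some z"
    using KS_tilde_extend[OF \<tau> _ _ _ z] below_mult[OF e f] idempotents_closed[OF e f] e f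
    by blast+
  then show "y = x" "\<tau> (e \<cdot> f) = Some x"
    using x y z by auto
qed

section \<open>Closedness and the conclusion\<close>

text \<open>
  Let \<open>\<tau>\<close> violate one of the conditions. If (1) fails for \<open>e \<le> f\<close>, then \<open>\<tau> e = x\<close> lies in \<open>X\<^sub>f\<close>
  too, and separating \<open>\<tau> f\<close> from \<open>x\<close> in the compactification of \<open>X\<^sub>f\<close> gives a neighbourhood
  on which (1) still fails. If (2) fails for \<open>e\<close> and \<open>f\<close>, with finite values \<open>x\<close> and \<open>y\<close>, the
  neighbourhood depends on whether they agree. For \<open>x \<noteq> y\<close>, keeping the two values in disjoint open
  sets is enough, as points of \<open>KS_tilde\<close> have equal finite values. For \<open>x = y\<close>, this point lies in
  \<open>X\<^bsub>e\<cdot>f\<^esub>\<close>, and the value at \<open>e \<cdot> f\<close> is kept near \<open>\<infinity>\<close> and away from the value at \<open>e\<close>.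
\<close>

lemma closedin_KS_tilde:
  assumes X: "locally_compact_space X" "Hausdorff_space X"
  shows "closedin product_space KS_tilde"
proof -
  let ?P = "topspace product_space"
  let ?D = "fix_dom \<theta>"
  let ?A = "\<lambda>e. Alexandroff_compactification (subtopology X (?D e))"
  let ?in = "\<lambda>e N. {\<sigma> \<in> ?P. \<sigma> e \<in> N}"
  let ?fin = "\<lambda>e G. ?in e (Some ` (?D e \<inter> G))"
  have open_in: "openin product_space (?in e N)" if "e \<in> idempotents" "openin (?A e) N" for e N
    using openin_product_space_coordinate[OF that] .
  have open_fin: "openin product_space (?fin e G)" if "e \<in> idempotents" "openin X G" for e G
    using that by (intro open_in openin_Alexandroff_compactification_Some)
  have "\<exists>W. openin product_space W \<and> \<tau> \<in> W \<and> W \<subseteq> ?P - KS_tilde"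
    if \<tau>: "\<tau> \<in> ?P" "\<tau> \<notin> KS_tilde" for \<tau>
  proof -
    consider (extend) e f x where "e \<in> idempotents" "f \<in> idempotents" "below e f"
        "\<tau> e = Some x" "\<tau> f \<noteq> Some x"
      | (meet) e f x y where "e \<in> idempotents" "f \<in> idempotents"
        "\<tau> e = Some x" "\<tau> f = Some y" "\<tau> (e \<cdot> f) = None"
      using \<tau> unfolding KS_tilde_def by fastforce
    then show ?thesis
    proof cases
      case extend
      have x: "x \<in> ?D e"
        using product_space_coordinate(2)[OF \<tau>(1)] extend by blast
      then have "x \<in> ?D f"
        using fix_dom_mono extend by blast
      then obtain G N where G: "openin X G" "x \<in> G" and N: "openin (?A f) N" "\<tau> f \<in> N"
        and disj: "Some ` G \<inter> N = {}"
        using separate_in_Alexandroff_compactification[OF X open_dom[OF extend(2)]]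
          product_space_coordinate(1)[OF \<tau>(1) extend(2)] extend(5)
        by metis
      show ?thesis
      proof (intro exI conjI)
        show "openin product_space (?fin e G \<inter> ?in f N)"
          using open_fin open_in extend G N by blast
        show "\<tau> \<in> ?fin e G \<inter> ?in f N"
          using \<tau> x extend G N by auto
        show "?fin e G \<inter> ?in f N \<subseteq> ?P - KS_tilde"
          using KS_tilde_extend[OF _ extend(1-3)] disj by fastforce
      qed
    next
      case meet
      have x: "x \<in> ?D e" and y: "y \<in> ?D f"
        using product_space_coordinate(2)[OF \<tau>(1)] meet by blast+
      show ?thesis
      proof (cases "x = y")
        case True
        have ef: "e \<cdot> f \<in> idempotents"
          using meet by (simp add: idempotents_closed)
        have "x \<in> ?D (e \<cdot> f)"
          using x y True meet by (simp add: fix_dom_mult)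
        then obtain G N where G: "openin X G" "x \<in> G"
          and N: "openin (?A (e \<cdot> f)) N" "\<tau> (e \<cdot> f) \<in> N" and disj: "Some ` G \<inter> N = {}"
          using separate_in_Alexandroff_compactification[OF X open_dom[OF ef]]
            product_space_coordinate(1)[OF \<tau>(1) ef] meet(5)
          by (metis option.distinct(1))
        show ?thesis
        proof (intro exI conjI)
          \<comment> \<open>The coordinate at \<open>f\<close> is constrained only to keep it finite, so that the value
            at \<open>e \<cdot> f\<close> of a point of \<open>KS_tilde\<close> would have to equal the value at \<open>e\<close>.\<close>
          show "openin product_space (?fin e G \<inter> ?fin f G \<inter> ?in (e \<cdot> f) N)"
            using open_fin open_in meet ef G N by blast
          show "\<tau> \<in> ?fin e G \<inter> ?fin f G \<inter> ?in (e \<cdot> f) N"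
            using \<tau> x y True meet G N by auto
          show "?fin e G \<inter> ?fin f G \<inter> ?in (e \<cdot> f) N \<subseteq> ?P - KS_tilde"
            using KS_tilde_coordinates_agree(2)[OF _ meet(1,2)] disj by fastforce
        qed
      next
        case False
        moreover have "x \<in> topspace X" "y \<in> topspace X"
          using x y open_dom meet openin_subset by blast+
        ultimately obtain G H where GH: "openin X G" "openin X H" "x \<in> G" "y \<in> H" "disjnt G H"
          using X(2) unfolding Hausdorff_space_def by metis
        show ?thesis
        proof (intro exI conjI)
          show "openin product_space (?fin e G \<inter> ?fin f H)"
            using open_fin meet GH by blast
          show "\<tau> \<in> ?fin e G \<inter> ?fin f H"
            using \<tau> x y meet GH by auto
          show "?fin e G \<inter> ?fin f H \<subseteq> ?P - KS_tilde"
            using KS_tilde_coordinates_agree(1)[OF _ meet(1,2)] GH(5)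
            by (fastforce simp: disjnt_def)
        qed
      qed
    qed
  qed
  then have "openin product_space (?P - KS_tilde)"
    by (subst openin_subopen) auto
  then show ?thesis
    by (auto simp: closedin_def KS_tilde_def)
qed

lemma compact_Hausdorff_product_space:
  assumes "locally_compact_space X" "Hausdorff_space X"
  shows "compact_space product_space" "Hausdorff_space product_space"
  using Hausdorff_space_Alexandroff_compactification_open_subset[OF assms open_dom]
  unfolding product_space_def
  by (auto simp: compact_space_product_topology Hausdorff_space_product_topology)

end

theorem lemma2p1p4:
  fixes S :: "'s set" and mult :: "'s \<Rightarrow> 's \<Rightarrow> 's"
    and X :: "'x topology" and \<theta> :: "'s \<Rightarrow> 'x \<rightharpoonup> 'x"
  assumes "inverse_semigroup_action S mult X \<theta>"
    and "locally_compact_space X" and "Hausdorff_space X"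
  shows "compact_space (inverse_semigroup_action.KS_tilde_space S mult X \<theta>)
    \<and> Hausdorff_space (inverse_semigroup_action.KS_tilde_space S mult X \<theta>)
    \<and> locally_compact_space (inverse_semigroup_action.KS_space S mult X \<theta>)
    \<and> Hausdorff_space (inverse_semigroup_action.KS_space S mult X \<theta>)"
proof -
  interpret inverse_semigroup_action S mult X \<theta>
    by fact
  note P = compact_Hausdorff_product_space[OF assms(2,3)]
  have compact: "compact_space KS_tilde_space"
    unfolding KS_tilde_space_def using P(1) closedin_KS_tilde[OF assms(2,3)]
    by (intro compact_space_subtopology closedin_compact_space)
  have Hausdorff: "Hausdorff_space KS_tilde_space"
    unfolding KS_tilde_space_def using P(2) by (rule Hausdorff_space_subtopology)
  have "topspace KS_tilde_space = KS_tilde"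
    unfolding KS_tilde_space_def by (auto simp: KS_tilde_def)
  then have "openin KS_tilde_space KS"
    using Hausdorff_imp_t1_space[OF Hausdorff] openin_topspace[of KS_tilde_space]
    unfolding KS_def t1_space_openin_delete_alt by metis
  then have "locally_compact_space KS_space"
    unfolding KS_space_def using compact Hausdorff
    by (simp add: locally_compact_space_open_subset compact_imp_locally_compact_space)
  moreover have "Hausdorff_space KS_space"
    unfolding KS_space_def using Hausdorff by (rule Hausdorff_space_subtopology)
  ultimately show ?thesis
    using compact Hausdorff by blast
qed

end
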